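(* Let $F$ be an infinite Fort space and let $(F,G)$ be a transformation group with $G$ abelian. Then $(F,G)$ is co-decomposable to non-Li--Yorke chaotic transformation groups; that is, there is a co-decomposition $(F,(G_\alpha;\alpha\in\Gamma))$ of $(F,G)$ such that for every $\alpha\in\Gamma$ the transformation group $(F,G_\alpha)$ is not Li--Yorke chaotic.
   Context: Fort space with particular point $b$: a set $F$ with a point $b\in F$ and the topology $\{U\subseteq F: b\notin U \text{ or } F\setminus U \text{ is finite}\}$; it is compact Hausdorff. A transformation group $(X,G)$ is a compact Hausdorff space $X$, a discrete group $G$ with identity $e$, and a continuous map $X\times G\to X$, $(x,g)\mapsto xg$, with $xe=x$ and $x(gh)=(xg)h$. A multi-transformation group $(X,(G_\alpha;\alpha\in\Gamma))$ ($\Gamma\ne\varnothing$) consists of transformation groups $(X,G_\alpha)$ such that for all distinct $\alpha_1,\dots,\alpha_n\in\Gamma$, all $x\in X$, $s_i\in G_{\alpha_i}$ and every permutation $\sigma$ of $\{1,\dots,n\}$, $(\cdots((xs_1)s_2)\cdots)s_n=(\cdots((xs_{\sigma(1)})s_{\sigma(2)})\cdots)s_{\sigma(n)}$. It is a co-decomposition of $(X,G)$ if the $G_\alpha$ are pairwise distinct subgroups of $G$ (acting on $X$ by restriction of the action of $G$) and $G$ is the group generated by $\bigcup_{\alpha\in\Gamma}G_\alpha$. Let $\mathcal F$ be the unique compatible uniform structure on $X$. In a transformation group $(X,G)$, points $x,y\in X$ are proximal if there are $z\in X$ and a net $(g_\lambda)$ in $G$ with $\lim xg_\lambda=z=\lim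 yg_\lambda$; they are asymptotic if $\{g\in G:(xg,yg)\notin\alpha\}$ is finite for every $\alpha\in\mathcal F$; they are scrambled if they are proximal and not asymptotic. $(X,G)$ is Li--Yorke chaotic if there is an uncountable set $D\subseteq X$ such that every two distinct points of $D$ are scrambled. *)

theory Defs
  imports
    "HOL-Analysis.Analysis"
    "HOL-Algebra.Generated_Groups"
    "HOL-Combinatorics.Permutations"
begin

section \<open>Fort spaces\<close>

definition fort_topology :: "'a set \<Rightarrow> 'a \<Rightarrow> 'a topology" where
  "fort_topology F b = topology (\<lambda>U. U \<subseteq> F \<and> (b \<notin> U \<or> finite (F - U)))"

lemma istopology_fort: "istopology (\<lambda>U. U \<subseteq> F \<and> (b \<notin> U \<or> finite (F - U)))"
  unfolding istopology_def
proof (intro conjI allI impI)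
  fix S T assume "S \<subseteq> F \<and> (b \<notin> S \<or> finite (F - S))" "T \<subseteq> F \<and> (b \<notin> T \<or> finite (F - T))"
  then show "S \<inter> T \<subseteq> F" "b \<notin> S \<inter> T \<or> finite (F - (S \<inter> T))"
    by (auto simp: Diff_Int)
next
  fix \<K> assume *: "\<forall>K\<in>\<K>. K \<subseteq> F \<and> (b \<notin> K \<or> finite (F - K))"
  then show "\<Union>\<K> \<subseteq> F" by blast
  show "b \<notin> \<Union>\<K> \<or> finite (F - \<Union>\<K>)"
  proof (cases "b \<in> \<Union>\<K>")
    case True
    then obtain K where "K \<in> \<K>" "b \<in> K" by blast
    with * have "finite (F - K)" by blast
    then have "finite (F - \<Union>\<K>)"
      by (rule rev_finite_subset) (use \<open>K \<in> \<K>\<close> in blast)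
    then show ?thesis ..
  qed simp
qed

lemma openin_fort_topology:
  "openin (fort_topology F b) U \<longleftrightarrow> U \<subseteq> F \<and> (b \<notin> U \<or> finite (F - U))"
  unfolding fort_topology_def topology_inverse'[OF istopology_fort] ..

lemma topspace_fort_topology [simp]: "topspace (fort_topology F b) = F"
proof
  show "topspace (fort_topology F b) \<subseteq> F"
    using openin_topspace[of "fort_topology F b"]
    unfolding openin_fort_topology by blast
  show "F \<subseteq> topspace (fort_topology F b)"
    by (rule openin_subset) (simp add: openin_fort_topology)
qed

lemma Hausdorff_space_fort_topology: "Hausdorff_space (fort_topology F b)"
  unfolding Hausdorff_space_def topspace_fort_topology
proof (intro allI impI)
  fix x y assume xy: "x \<in> F \<and> y \<in> F \<and> x \<noteq> y"
  have *: "\<exists>U V. openin (fort_topology F b) U \<and> openin (fort_topology F b) V \<and>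
             u \<in> U \<and> v \<in> V \<and> disjnt U V"
    if "u \<in> F" "v \<in> F" "u \<noteq> v" "u \<noteq> b" for u v
  proof -
    have "openin (fort_topology F b) {u}" "openin (fort_topology F b) (F - {u})"
      using that by (auto simp: openin_fort_topology Diff_Diff_Int)
    moreover have "u \<in> {u}" "v \<in> F - {u}" "disjnt {u} (F - {u})"
      using that by (auto simp: disjnt_def)
    ultimately show ?thesis by blast
  qed
  show "\<exists>U V. openin (fort_topology F b) U \<and> openin (fort_topology F b) V \<and>
             x \<in> U \<and> y \<in> V \<and> disjnt U V"
  proof (cases "x = b")
    case True
    with xy *[of y x] obtain U V where "openin (fort_topology F b) U" "openin (fort_topology F b) V"
      "y \<in> U" "x \<in> V" "disjnt U V" by blast
    then show ?thesis using disjnt_sym by blast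
  next
    case False
    with xy *[of x y] show ?thesis by simp
  qed
qed

lemma compact_space_fort_topology:
  assumes "b \<in> F"
  shows "compact_space (fort_topology F b)"
  unfolding compact_space_alt topspace_fort_topology
proof (intro allI impI)
  fix \<U> assume \<U>: "(\<forall>U\<in>\<U>. openin (fort_topology F b) U) \<and> F \<subseteq> \<Union>\<U>"
  with assms obtain U where U: "U \<in> \<U>" "b \<in> U" by blast
  with \<U> have "finite (F - U)" by (auto simp: openin_fort_topology)
  moreover have "F - U \<subseteq> \<Union>\<U>" using \<U> by blast
  ultimately obtain \<F> where "finite \<F>" "\<F> \<subseteq> \<U>" "F - U \<subseteq> \<Union>\<F>"
    using finite_subset_Union by metis
  then show "\<exists>\<F>. finite \<F> \<and> \<F> \<subseteq> \<U> \<and> F \<subseteq> \<Union>\<F>"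
    using U by (intro exI[of _ "insert U \<F>"]) auto
qed


section \<open>The uniform structure of a compact Hausdorff space\<close>

text \<open>The library has uniform spaces only as a type class, so entourages on a carrier set
  are introduced here.\<close>

definition uniform_structure :: "'a set \<Rightarrow> ('a \<times> 'a) set set \<Rightarrow> bool" where
  "uniform_structure S \<F> \<longleftrightarrow>
     \<F> \<noteq> {} \<and>
     (\<forall>V\<in>\<F>. Id_on S \<subseteq> V \<and> V \<subseteq> S \<times> S) \<and>
     (\<forall>V\<in>\<F>. \<forall>W. V \<subseteq> W \<and> W \<subseteq> S \<times> S \<longrightarrow> W \<in> \<F>) \<and>
     (\<forall>V\<in>\<F>. \<forall>W\<in>\<F>. V \<inter> W \<in> \<F>) \<and>
     (\<forall>V\<in>\<F>. V\<inverse> \<in> \<F>) \<and>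
     (\<forall>V\<in>\<F>. \<exists>W\<in>\<F>. W O W \<subseteq> V)"

definition compatible_uniformity :: "'a topology \<Rightarrow> ('a \<times> 'a) set set \<Rightarrow> bool" where
  "compatible_uniformity X \<F> \<longleftrightarrow>
     uniform_structure (topspace X) \<F> \<and>
     (\<forall>U. openin X U \<longleftrightarrow> U \<subseteq> topspace X \<and> (\<forall>x\<in>U. \<exists>V\<in>\<F>. V `` {x} \<subseteq> U))"

text \<open>Meaningful for compact Hausdorff \<open>X\<close>; see \<open>ex1_compatible_uniformity\<close> below.\<close>

definition the_uniformity :: "'a topology \<Rightarrow> ('a \<times> 'a) set set" where
  "the_uniformity X = (THE \<F>. compatible_uniformity X \<F>)"

definition diagonal_nhds :: "'a topology \<Rightarrow> ('a \<times> 'a) set set" where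
  "diagonal_nhds X = {V. V \<subseteq> topspace X \<times> topspace X \<and>
     (\<exists>W. openin (prod_topology X X) W \<and> Id_on (topspace X) \<subseteq> W \<and> W \<subseteq> V)}"

lemma diagonal_nhds_half:
  assumes "compact_space X" "Hausdorff_space X" "V \<in> diagonal_nhds X"
  shows "\<exists>W\<in>diagonal_nhds X. W O W \<subseteq> V"
proof -
  obtain W where W: "openin (prod_topology X X) W" "Id_on (topspace X) \<subseteq> W" "W \<subseteq> V"
    using assms by (auto simp: diagonal_nhds_def)
  have "\<exists>A B C. openin X A \<and> openin X B \<and> closedin X C \<and> x \<in> B \<and> B \<subseteq> C \<and> C \<subseteq> A \<and> A \<times> A \<subseteq> W"
    if "x \<in> topspace X" for x
  proof -
    have "(x, x) \<in> W" using W that by blast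
    then obtain A1 A2 where A: "openin X A1" "openin X A2" "x \<in> A1" "x \<in> A2" "A1 \<times> A2 \<subseteq> W"
      using W(1) unfolding openin_prod_topology_alt by meson
    have "neighbourhood_base_of (closedin X) X"
      using assms compact_Hausdorff_imp_regular_space neighbourhood_base_of_closedin by blast
    moreover have "openin X (A1 \<inter> A2)" "x \<in> A1 \<inter> A2" using A by auto
    ultimately obtain B C where "openin X B" "closedin X C" "x \<in> B" "B \<subseteq> C" "C \<subseteq> A1 \<inter> A2"
      unfolding neighbourhood_base_of by meson
    moreover have "(A1 \<inter> A2) \<times> (A1 \<inter> A2) \<subseteq> W" using A by blast
    ultimately show ?thesis using \<open>openin X (A1 \<inter> A2)\<close> by meson
  qed
  then obtain A B C where ABC: "\<And>x. x \<in> topspace X \<Longrightarrow>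
      openin X (A x) \<and> openin X (B x) \<and> closedin X (C x) \<and> x \<in> B x \<and> B x \<subseteq> C x \<and> C x \<subseteq> A x \<and>
      A x \<times> A x \<subseteq> W"
    by metis
  have "\<exists>\<G>. finite \<G> \<and> \<G> \<subseteq> B ` topspace X \<and> topspace X \<subseteq> \<Union>\<G>"
      using compact_space_alt[THEN iffD1, rule_format, OF assms(1), of "B ` topspace X"] ABC by blast
  then obtain K where K: "finite K" "K \<subseteq> topspace X" "topspace X \<subseteq> \<Union>(B ` K)"
    by (metis finite_subset_image)
  define N where "N = (topspace X \<times> topspace X) \<inter>
     (\<Inter>x\<in>K. (A x \<times> A x) \<union> ((topspace X - C x) \<times> (topspace X - C x)))"
  have "openin (prod_topology X X) N"
  proof (cases "K = {}")
    case True
    then show ?thesis by (simp add: N_def openin_prod_Times_iff)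
  next
    case False
    have "openin (prod_topology X X) ((A x \<times> A x) \<union> ((topspace X - C x) \<times> (topspace X - C x)))"
      if "x \<in> K" for x
      using ABC[of x] that K(2) by (intro openin_Un) (auto simp: openin_prod_Times_iff intro!: openin_diff)
    then show ?thesis unfolding N_def
      by (intro openin_Int openin_INT2) (use False K in \<open>auto simp: openin_prod_Times_iff\<close>)
  qed
  moreover have "Id_on (topspace X) \<subseteq> N"
  proof
    fix p assume "p \<in> Id_on (topspace X)"
    then obtain x where x: "x \<in> topspace X" "p = (x, x)" by auto
    have "x \<in> A k \<or> x \<notin> C k" if "k \<in> K" for k
      using ABC[of k] that K(2) by blast
    then show "p \<in> N" using x by (auto simp: N_def)
  qed
  ultimately have "N \<in> diagonal_nhds X"
    by (auto simp: diagonal_nhds_def N_def)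
  moreover have "N O N \<subseteq> V"
  proof clarify
    fix x y z assume xy: "(x, y) \<in> N" and yz: "(y, z) \<in> N"
    then have "y \<in> topspace X" by (simp add: N_def)
    then obtain k where k: "k \<in> K" "y \<in> B k" using K(3) by blast
    with ABC[of k] K(2) have "y \<in> C k" "A k \<times> A k \<subseteq> W" by blast+
    moreover from this xy yz k(1) have "x \<in> A k" "z \<in> A k" by (auto simp: N_def)
    ultimately show "(x, z) \<in> V" using W(3) by blast
  qed
  ultimately show ?thesis by blast
qed

lemma compatible_diagonal_nhds:
  assumes "compact_space X" "Hausdorff_space X"
  shows "compatible_uniformity X (diagonal_nhds X)"
  unfolding compatible_uniformity_def
proof (intro conjI allI iffI)
  have top: "openin (prod_topology X X) (topspace X \<times> topspace X)"
    by (simp add: openin_prod_Times_iff)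
  have conv: "openin (prod_topology X X) (W\<inverse>)" if W: "openin (prod_topology X X) W" for W
    unfolding openin_prod_topology_alt
  proof (intro allI impI)
    fix x y assume "(x, y) \<in> W\<inverse>"
    then have "(y, x) \<in> W" by simp
    then obtain U V where "openin X U" "openin X V" "y \<in> U" "x \<in> V" "U \<times> V \<subseteq> W"
      using W unfolding openin_prod_topology_alt by meson
    moreover from this have "V \<times> U \<subseteq> W\<inverse>" by blast
    ultimately show "\<exists>U V. openin X U \<and> openin X V \<and> x \<in> U \<and> y \<in> V \<and> U \<times> V \<subseteq> W\<inverse>"
      by meson
  qed
  have A: "\<forall>V\<in>diagonal_nhds X. \<forall>W\<in>diagonal_nhds X. V \<inter> W \<in> diagonal_nhds X"
  proof (intro ballI)
    fix V W assume "V \<in> diagonal_nhds X" "W \<in> diagonal_nhds X"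
    then obtain V' W' where "openin (prod_topology X X) V'" "Id_on (topspace X) \<subseteq> V'" "V' \<subseteq> V"
      "openin (prod_topology X X) W'" "Id_on (topspace X) \<subseteq> W'" "W' \<subseteq> W"
      "V \<subseteq> topspace X \<times> topspace X"
      unfolding diagonal_nhds_def by blast
    then show "V \<inter> W \<in> diagonal_nhds X" unfolding diagonal_nhds_def
      by (intro CollectI conjI exI[of _ "V' \<inter> W'"] openin_Int) auto
  qed
  have B: "\<forall>V\<in>diagonal_nhds X. V\<inverse> \<in> diagonal_nhds X"
  proof
    fix V assume "V \<in> diagonal_nhds X"
    then obtain V' where "openin (prod_topology X X) V'" "Id_on (topspace X) \<subseteq> V'" "V' \<subseteq> V"
      "V \<subseteq> topspace X \<times> topspace X"
      unfolding diagonal_nhds_def by blast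
    then show "V\<inverse> \<in> diagonal_nhds X" unfolding diagonal_nhds_def
      by (intro CollectI conjI exI[of _ "V'\<inverse>"] conv) auto
  qed
  have C: "topspace X \<times> topspace X \<in> diagonal_nhds X"
    unfolding diagonal_nhds_def
    by (intro CollectI conjI exI[of _ "topspace X \<times> topspace X"] top) auto
  show "uniform_structure (topspace X) (diagonal_nhds X)"
    unfolding uniform_structure_def
  proof (intro conjI A B)
    show "\<forall>V\<in>diagonal_nhds X. \<exists>W\<in>diagonal_nhds X. W O W \<subseteq> V"
      using diagonal_nhds_half[OF assms] by blast
    show "\<forall>V\<in>diagonal_nhds X. Id_on (topspace X) \<subseteq> V \<and> V \<subseteq> topspace X \<times> topspace X"
      unfolding diagonal_nhds_def by blast
    show "\<forall>V\<in>diagonal_nhds X. \<forall>W. V \<subseteq> W \<and> W \<subseteq> topspace X \<times> topspace X \<longrightarrow> W \<in> diagonal_nhds X"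
    proof (intro ballI allI impI)
      fix V W assume "V \<in> diagonal_nhds X" "V \<subseteq> W \<and> W \<subseteq> topspace X \<times> topspace X"
      then obtain V' where "openin (prod_topology X X) V'" "Id_on (topspace X) \<subseteq> V'" "V' \<subseteq> W"
        "W \<subseteq> topspace X \<times> topspace X"
        unfolding diagonal_nhds_def by blast
      then show "W \<in> diagonal_nhds X"
        unfolding diagonal_nhds_def by blast
    qed
    show "diagonal_nhds X \<noteq> {}" using C by blast
  qed
next
  fix U assume "openin X U"
  then show "U \<subseteq> topspace X" by (rule openin_subset)
next
  fix U assume U: "openin X U"
  show "\<forall>x\<in>U. \<exists>V\<in>diagonal_nhds X. V `` {x} \<subseteq> U"
  proof
    fix x assume x: "x \<in> U"
    define V where "V = U \<times> U \<union> (topspace X - {x}) \<times> (topspace X - {x})"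
    have "closedin X {x}"
      using x openin_subset[OF U] assms(2)
      by (auto intro: closedin_t1_singleton Hausdorff_imp_t1_space)
    then have "openin (prod_topology X X) V" unfolding V_def
      using U by (intro openin_Un) (auto simp: openin_prod_Times_iff intro!: openin_diff)
    moreover have "Id_on (topspace X) \<subseteq> V" "V \<subseteq> topspace X \<times> topspace X"
      using x openin_subset[OF U] by (auto simp: V_def)
    ultimately have "V \<in> diagonal_nhds X"
      unfolding diagonal_nhds_def by blast
    then show "\<exists>V\<in>diagonal_nhds X. V `` {x} \<subseteq> U"
      by (rule bexI[rotated]) (auto simp: V_def)
  qed
next
  fix U assume U: "U \<subseteq> topspace X \<and> (\<forall>x\<in>U. \<exists>V\<in>diagonal_nhds X. V `` {x} \<subseteq> U)"
  show "openin X U"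
  proof (subst openin_subopen, intro ballI)
    fix x assume x: "x \<in> U"
    with U obtain V where "V \<in> diagonal_nhds X" "V `` {x} \<subseteq> U" by blast
    then obtain W where "V `` {x} \<subseteq> U" "openin (prod_topology X X) W"
      "Id_on (topspace X) \<subseteq> W" "W \<subseteq> V"
      unfolding diagonal_nhds_def by blast
    moreover from this x U have "(x, x) \<in> W" by (meson Id_onI subsetD)
    ultimately obtain A B where "openin X A" "openin X B" "x \<in> A" "x \<in> B" "A \<times> B \<subseteq> W"
      unfolding openin_prod_topology_alt by metis
    with \<open>V `` {x} \<subseteq> U\<close> \<open>W \<subseteq> V\<close> show "\<exists>T. openin X T \<and> x \<in> T \<and> T \<subseteq> U"
      by (intro exI[of _ B]) auto
  qed
qed

lemma compatible_uniformity_nhd: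
  assumes "compatible_uniformity X \<F>" "V \<in> \<F>" "x \<in> topspace X"
  shows "\<exists>U. openin X U \<and> x \<in> U \<and> U \<subseteq> V `` {x}"
proof -
  define U where "U = {y \<in> topspace X. \<exists>W\<in>\<F>. W `` {y} \<subseteq> V `` {x}}"
  have us: "uniform_structure (topspace X) \<F>" and
    op: "\<And>U. openin X U \<longleftrightarrow> U \<subseteq> topspace X \<and> (\<forall>x\<in>U. \<exists>V\<in>\<F>. V `` {x} \<subseteq> U)"
    using assms(1) by (auto simp: compatible_uniformity_def)
  have "openin X U" unfolding op
  proof (intro conjI ballI)
    fix y assume "y \<in> U"
    then obtain W where W: "W \<in> \<F>" "W `` {y} \<subseteq> V `` {x}" "y \<in> topspace X"
      by (auto simp: U_def)
    then obtain W' where W': "W' \<in> \<F>" "W' O W' \<subseteq> W"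
      using us unfolding uniform_structure_def by metis
    have sub: "W' \<subseteq> topspace X \<times> topspace X"
      using us W'(1) unfolding uniform_structure_def by blast
    have "W' `` {y} \<subseteq> U"
    proof
      fix z assume z: "z \<in> W' `` {y}"
      then have "W' `` {z} \<subseteq> V `` {x}" using W W' by blast
      moreover have "z \<in> topspace X" using z sub by blast
      ultimately show "z \<in> U" using W'(1) by (auto simp: U_def)
    qed
    then show "\<exists>V\<in>\<F>. V `` {y} \<subseteq> U" using W'(1) by blast
  qed (auto simp: U_def)
  moreover have "x \<in> U" using assms by (auto simp: U_def)
  moreover have "U \<subseteq> V `` {x}"
  proof
    fix y assume "y \<in> U"
    then obtain W where W: "W \<in> \<F>" "W `` {y} \<subseteq> V `` {x}" "y \<in> topspace X"
      by (auto simp: U_def)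
    then have "(y, y) \<in> W" using us unfolding uniform_structure_def by blast
    with W show "y \<in> V `` {x}" by blast
  qed
  ultimately show ?thesis by blast
qed

lemma compatible_uniformity_eq_diagonal_nhds:
  assumes "compact_space X" "compatible_uniformity X \<F>"
  shows "\<F> = diagonal_nhds X"
proof
  have us: "uniform_structure (topspace X) \<F>" and
    op: "\<And>U. openin X U \<longleftrightarrow> U \<subseteq> topspace X \<and> (\<forall>x\<in>U. \<exists>V\<in>\<F>. V `` {x} \<subseteq> U)"
    using assms(2) by (auto simp: compatible_uniformity_def)
  have refl: "\<And>V. V \<in> \<F> \<Longrightarrow> Id_on (topspace X) \<subseteq> V \<and> V \<subseteq> topspace X \<times> topspace X"
    and up: "\<And>V W. V \<in> \<F> \<Longrightarrow> V \<subseteq> W \<Longrightarrow> W \<subseteq> topspace X \<times> topspace X \<Longrightarrow> W \<in> \<F>"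
    and int: "\<And>V W. V \<in> \<F> \<Longrightarrow> W \<in> \<F> \<Longrightarrow> V \<inter> W \<in> \<F>"
    and conv: "\<And>V. V \<in> \<F> \<Longrightarrow> V\<inverse> \<in> \<F>"
    and half: "\<And>V. V \<in> \<F> \<Longrightarrow> \<exists>W\<in>\<F>. W O W \<subseteq> V"
    and ne: "\<F> \<noteq> {}"
    using us unfolding uniform_structure_def by blast+
  note nhd = compatible_uniformity_nhd[OF assms(2)]
  show "\<F> \<subseteq> diagonal_nhds X"
  proof
    fix V assume V: "V \<in> \<F>"
    then obtain V0 where V0: "V0 \<in> \<F>" "V0 O V0 \<subseteq> V" using half by blast
    define V' where "V' = V0 \<inter> V0\<inverse>"
    have V': "V' \<in> \<F>" using V0 int conv by (simp add: V'_def)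
    define W where "W = \<Union>{A \<times> A | A. openin X A \<and> A \<times> A \<subseteq> V}"
    have "openin (prod_topology X X) W" unfolding W_def
      by (rule openin_Union) (auto simp: openin_prod_Times_iff)
    moreover have "W \<subseteq> V" by (auto simp: W_def)
    moreover have "Id_on (topspace X) \<subseteq> W"
    proof
      fix p assume "p \<in> Id_on (topspace X)"
      then obtain x where x: "x \<in> topspace X" "p = (x, x)" by auto
      obtain A where A: "openin X A" "x \<in> A" "A \<subseteq> V' `` {x}" using nhd[OF V' x(1)] by blast
      have "A \<times> A \<subseteq> V" using A(3) V0(2) unfolding V'_def by blast
      with A x show "p \<in> W" by (auto simp: W_def)
    qed
    ultimately show "V \<in> diagonal_nhds X" using refl[OF V] by (auto simp: diagonal_nhds_def)
  qed
  show "diagonal_nhds X \<subseteq> \<F>"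
  proof
    fix V assume "V \<in> diagonal_nhds X"
    then obtain W where W: "openin (prod_topology X X) W" "Id_on (topspace X) \<subseteq> W" "W \<subseteq> V"
      and V: "V \<subseteq> topspace X \<times> topspace X"
      by (auto simp: diagonal_nhds_def)
    have "\<exists>E B. E \<in> \<F> \<and> openin X B \<and> x \<in> B \<and> (\<forall>y\<in>B. \<forall>z. (y, z) \<in> E \<longrightarrow> (y, z) \<in> W)"
      if x: "x \<in> topspace X" for x
    proof -
      have "(x, x) \<in> W" using W x by blast
      then obtain A1 A2 where A: "openin X A1" "openin X A2" "x \<in> A1" "x \<in> A2" "A1 \<times> A2 \<subseteq> W"
        using W(1) unfolding openin_prod_topology_alt by meson
      then have "openin X (A1 \<inter> A2)" "x \<in> A1 \<inter> A2" by auto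
      then obtain D where D: "D \<in> \<F>" "D `` {x} \<subseteq> A1 \<inter> A2" using op by meson
      obtain E where E: "E \<in> \<F>" "E O E \<subseteq> D" using half[OF D(1)] by blast
      obtain B where B: "openin X B" "x \<in> B" "B \<subseteq> E `` {x}" using nhd[OF E(1) x] by blast
      have "(y, z) \<in> W" if "y \<in> B" "(y, z) \<in> E" for y z
      proof -
        have "(x, y) \<in> E" using B that by blast
        moreover have "(y, y) \<in> E"
          using refl[OF E(1)] openin_subset[OF B(1)] that by blast
        ultimately have "y \<in> D `` {x}" "z \<in> D `` {x}" using E(2) that by blast+
        then show ?thesis using D(2) A(5) by blast
      qed
      with E B show ?thesis by blast
    qed
    then obtain E B where EB: "\<And>x. x \<in> topspace X \<Longrightarrow> E x \<in> \<F> \<and> openin X (B x) \<and> x \<in> B x \<and>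
        (\<forall>y\<in>B x. \<forall>z. (y, z) \<in> E x \<longrightarrow> (y, z) \<in> W)"
      by metis
    have "\<exists>\<G>. finite \<G> \<and> \<G> \<subseteq> B ` topspace X \<and> topspace X \<subseteq> \<Union>\<G>"
      using compact_space_alt[THEN iffD1, rule_format, OF assms(1), of "B ` topspace X"] EB by blast
    then obtain K where K: "finite K" "K \<subseteq> topspace X" "topspace X \<subseteq> \<Union>(B ` K)"
      by (metis finite_subset_image)
    obtain V1 where "V1 \<in> \<F>" using ne by blast
    have "V1 \<inter> \<Inter>(E ` K) \<in> \<F>" using K(1,2)
    proof (induction K rule: finite_induct)
      case (insert k K)
      then have "E k \<inter> (V1 \<inter> \<Inter>(E ` K)) \<in> \<F>" using EB int by simp
      then show ?case by (simp add: Int_left_commute)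
    qed (use \<open>V1 \<in> \<F>\<close> in simp)
    moreover have "V1 \<inter> \<Inter>(E ` K) \<subseteq> V"
    proof clarify
      fix y z assume yz: "(y, z) \<in> V1" "(y, z) \<in> \<Inter>(E ` K)"
      then have "y \<in> topspace X" using refl[OF \<open>V1 \<in> \<F>\<close>] by blast
      then obtain k where "k \<in> K" "y \<in> B k" using K(3) by blast
      with EB yz K(2) W(3) show "(y, z) \<in> V" by blast
    qed
    ultimately show "V \<in> \<F>" using up V by blast
  qed
qed

lemma ex1_compatible_uniformity:
  assumes "compact_space X" "Hausdorff_space X"
  shows "\<exists>!\<F>. compatible_uniformity X \<F>"
  using compatible_diagonal_nhds[OF assms] compatible_uniformity_eq_diagonal_nhds[OF assms(1)]
  by blast


section \<open>Transformation groups and co-decompositions\<close>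

definition transformation_group ::
    "'a topology \<Rightarrow> ('g, 'm) monoid_scheme \<Rightarrow> ('a \<Rightarrow> 'g \<Rightarrow> 'a) \<Rightarrow> bool" where
  "transformation_group X G act \<longleftrightarrow>
     compact_space X \<and> Hausdorff_space X \<and> group G \<and>
     continuous_map (prod_topology X (discrete_topology (carrier G))) X (\<lambda>(x, g). act x g) \<and>
     (\<forall>x\<in>topspace X. act x \<one>\<^bsub>G\<^esub> = x) \<and>
     (\<forall>x\<in>topspace X. \<forall>g\<in>carrier G. \<forall>h\<in>carrier G. act x (g \<otimes>\<^bsub>G\<^esub> h) = act (act x g) h)"

definition multi_transformation_group ::
    "'a topology \<Rightarrow> 'i set \<Rightarrow> ('i \<Rightarrow> ('g, 'm) monoid_scheme) \<Rightarrow> ('i \<Rightarrow> 'a \<Rightarrow> 'g \<Rightarrow> 'a) \<Rightarrow> bool" where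
  "multi_transformation_group X \<Gamma> G act \<longleftrightarrow>
     \<Gamma> \<noteq> {} \<and>
     (\<forall>\<alpha>\<in>\<Gamma>. transformation_group X (G \<alpha>) (act \<alpha>)) \<and>
     (\<forall>(n::nat) \<alpha> x s \<sigma>.
        inj_on \<alpha> {1..n} \<and> \<alpha> ` {1..n} \<subseteq> \<Gamma> \<and> x \<in> topspace X \<and>
        (\<forall>i\<in>{1..n}. s i \<in> carrier (G (\<alpha> i))) \<and> \<sigma> permutes {1..n} \<longrightarrow>
        foldl (\<lambda>y i. act (\<alpha> i) y (s i)) x [1..<Suc n] =
        foldl (\<lambda>y i. act (\<alpha> (\<sigma> i)) y (s (\<sigma> i))) x [1..<Suc n])"

definition co_decomposition ::
    "'a topology \<Rightarrow> ('g, 'm) monoid_scheme \<Rightarrow> ('a \<Rightarrow> 'g \<Rightarrow> 'a) \<Rightarrow> 'i set \<Rightarrow> ('i \<Rightarrow> 'g set) \<Rightarrow> bool" where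
  "co_decomposition X G act \<Gamma> H \<longleftrightarrow>
     transformation_group X G act \<and>
     (\<forall>\<alpha>\<in>\<Gamma>. subgroup (H \<alpha>) G) \<and> inj_on H \<Gamma> \<and>
     multi_transformation_group X \<Gamma> (\<lambda>\<alpha>. G\<lparr>carrier := H \<alpha>\<rparr>) (\<lambda>\<alpha>. act) \<and>
     generate G (\<Union>\<alpha>\<in>\<Gamma>. H \<alpha>) = carrier G"


section \<open>Li--Yorke chaos\<close>

text \<open>As usual in the library, nets are rendered by proper filters: the net is replaced by the
  image in \<open>G\<close> of the filter of tails of its index set. Agreement with nets in the classical
  sense is \<open>proximal_if_net\<close> and \<open>proximal_imp_net\<close>.\<close>

definition proximal ::
    "'a topology \<Rightarrow> ('g, 'm) monoid_scheme \<Rightarrow> ('a \<Rightarrow> 'g \<Rightarrow> 'a) \<Rightarrow> 'a \<Rightarrow> 'a \<Rightarrow> bool" where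
  "proximal X G act x y \<longleftrightarrow>
     (\<exists>z\<in>topspace X. \<exists>\<Phi>. \<Phi> \<noteq> bot \<and> (\<forall>\<^sub>F g in \<Phi>. g \<in> carrier G) \<and>
        limitin X (act x) z \<Phi> \<and> limitin X (act y) z \<Phi>)"

definition asymptotic ::
    "'a topology \<Rightarrow> ('g, 'm) monoid_scheme \<Rightarrow> ('a \<Rightarrow> 'g \<Rightarrow> 'a) \<Rightarrow> 'a \<Rightarrow> 'a \<Rightarrow> bool" where
  "asymptotic X G act x y \<longleftrightarrow>
     (\<forall>V\<in>the_uniformity X. finite {g \<in> carrier G. (act x g, act y g) \<notin> V})"

definition scrambled ::
    "'a topology \<Rightarrow> ('g, 'm) monoid_scheme \<Rightarrow> ('a \<Rightarrow> 'g \<Rightarrow> 'a) \<Rightarrow> 'a \<Rightarrow> 'a \<Rightarrow> bool" where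
  "scrambled X G act x y \<longleftrightarrow> proximal X G act x y \<and> \<not> asymptotic X G act x y"

definition Li_Yorke_chaotic ::
    "'a topology \<Rightarrow> ('g, 'm) monoid_scheme \<Rightarrow> ('a \<Rightarrow> 'g \<Rightarrow> 'a) \<Rightarrow> bool" where
  "Li_Yorke_chaotic X G act \<longleftrightarrow>
     (\<exists>D\<subseteq>topspace X. uncountable D \<and>
        (\<forall>x\<in>D. \<forall>y\<in>D. x \<noteq> y \<longrightarrow> scrambled X G act x y))"

definition directed_by :: "'i set \<Rightarrow> ('i \<Rightarrow> 'i \<Rightarrow> bool) \<Rightarrow> bool" where
  "directed_by I pre \<longleftrightarrow> I \<noteq> {} \<and> (\<forall>i\<in>I. pre i i) \<and>
     (\<forall>i\<in>I. \<forall>j\<in>I. \<forall>k\<in>I. pre i j \<and> pre j k \<longrightarrow> pre i k) \<and>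
     (\<forall>i\<in>I. \<forall>j\<in>I. \<exists>k\<in>I. pre i k \<and> pre j k)"

definition net_limit ::
    "'a topology \<Rightarrow> 'i set \<Rightarrow> ('i \<Rightarrow> 'i \<Rightarrow> bool) \<Rightarrow> ('i \<Rightarrow> 'a) \<Rightarrow> 'a \<Rightarrow> bool" where
  "net_limit X I pre f z \<longleftrightarrow> z \<in> topspace X \<and>
     (\<forall>U. openin X U \<and> z \<in> U \<longrightarrow> (\<exists>i\<in>I. \<forall>j\<in>I. pre i j \<longrightarrow> f j \<in> U))"

lemma proximal_if_net:
  assumes I: "directed_by I pre" and g: "\<And>i. i \<in> I \<Longrightarrow> g i \<in> carrier G"
    and x: "net_limit X I pre (\<lambda>i. act x (g i)) z" and y: "net_limit X I pre (\<lambda>i. act y (g i)) z"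
  shows "proximal X G act x y"
proof -
  define T where "T = (\<lambda>i. {j \<in> I. pre i j})"
  define \<Psi> where "\<Psi> = (INF i\<in>I. principal (T i))"
  have ne: "I \<noteq> {}" and rfl: "\<forall>i\<in>I. pre i i"
    using I unfolding directed_by_def by blast+
  have ev: "eventually P \<Psi> \<longleftrightarrow> (\<exists>i\<in>I. \<forall>j\<in>T i. P j)" for P
  proof -
    have dir: "\<exists>k\<in>I. principal (T k) \<le> inf (principal (T i)) (principal (T j))"
      if ij: "i \<in> I" "j \<in> I" for i j
    proof -
      obtain k where k: "k \<in> I" "pre i k" "pre j k"
        using I ij unfolding directed_by_def by metis
      have "T k \<subseteq> T i \<inter> T j"
      proof
        fix l assume "l \<in> T k"
        then have l: "l \<in> I" "pre k l" by (auto simp: T_def)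
        have "pre a d" if "a \<in> I" "c \<in> I" "d \<in> I" "pre a c" "pre c d" for a c d
          using I that unfolding directed_by_def by metis
        then have "pre i l" "pre j l" using ij k l by blast+
        with l(1) show "l \<in> T i \<inter> T j" by (simp add: T_def)
      qed
      then have "principal (T k) \<le> inf (principal (T i)) (principal (T j))" by simp
      with k(1) show ?thesis by blast
    qed
    show ?thesis unfolding \<Psi>_def
      by (subst eventually_INF_base) (use ne dir in \<open>auto simp: eventually_principal inf.commute\<close>)
  qed
  define \<Phi> where "\<Phi> = filtermap g \<Psi>"
  have "\<Psi> \<noteq> bot"
    unfolding trivial_limit_def ev using ne rfl by (auto simp: T_def)
  then have "\<Phi> \<noteq> bot" by (simp add: \<Phi>_def filtermap_bot_iff)
  moreover have "\<forall>\<^sub>F h in \<Phi>. h \<in> carrier G"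
    unfolding \<Phi>_def eventually_filtermap ev using ne g by (auto simp: T_def)
  moreover have "limitin X (act u) z \<Phi>" if "net_limit X I pre (\<lambda>i. act u (g i)) z" for u
    using that unfolding limitin_def \<Phi>_def eventually_filtermap ev net_limit_def
    by (simp add: T_def) blast
  moreover have "z \<in> topspace X" using x by (simp add: net_limit_def)
  ultimately show ?thesis
    using x y unfolding proximal_def by blast
qed

lemma proximal_imp_net:
  fixes G :: "('g, 'm) monoid_scheme"
  assumes "proximal X G act x y"
  shows "\<exists>(I :: ('g \<times> 'g set) set) pre g z. directed_by I pre \<and> (\<forall>i\<in>I. g i \<in> carrier G) \<and>
           net_limit X I pre (\<lambda>i. act x (g i)) z \<and> net_limit X I pre (\<lambda>i. act y (g i)) z"
proof -
  obtain z \<Phi> where \<Phi>: "\<Phi> \<noteq> bot" "\<forall>\<^sub>F g in \<Phi>. g \<in> carrier G"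
    and x: "limitin X (act x) z \<Phi>" and y: "limitin X (act y) z \<Phi>"
    using assms unfolding proximal_def by blast
  define I where "I = {(g, A). g \<in> A \<and> A \<subseteq> carrier G \<and> (\<forall>\<^sub>F h in \<Phi>. h \<in> A)}"
  define pre :: "'g \<times> 'g set \<Rightarrow> 'g \<times> 'g set \<Rightarrow> bool" where "pre = (\<lambda>p q. snd q \<subseteq> snd p)"
  have ex: "\<exists>g. (g, A) \<in> I" if "A \<subseteq> carrier G" "\<forall>\<^sub>F h in \<Phi>. h \<in> A" for A
    using that \<Phi>(1) eventually_happens'[of \<Phi> "\<lambda>h. h \<in> A"] by (auto simp: I_def)
  have "directed_by I pre"
    unfolding directed_by_def
  proof (intro conjI ballI)
    show "I \<noteq> {}" using ex[of "carrier G"] \<Phi>(2) by auto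
    fix i j assume ij: "i \<in> I" "j \<in> I"
    then have "snd i \<inter> snd j \<subseteq> carrier G" "\<forall>\<^sub>F h in \<Phi>. h \<in> snd i \<inter> snd j"
      by (auto simp: I_def eventually_conj_iff)
    then obtain g where "(g, snd i \<inter> snd j) \<in> I"
      using ex by blast
    then show "\<exists>k\<in>I. pre i k \<and> pre j k" by (intro bexI[of _ "(g, snd i \<inter> snd j)"]) (auto simp: pre_def)
  qed (auto simp: pre_def)
  moreover have "\<forall>i\<in>I. fst i \<in> carrier G" by (auto simp: I_def)
  moreover have "net_limit X I pre (\<lambda>i. act u (fst i)) z" if u: "limitin X (act u) z \<Phi>" for u
    unfolding net_limit_def
  proof (intro conjI allI impI)
    show "z \<in> topspace X" using u by (simp add: limitin_def)
    fix U assume "openin X U \<and> z \<in> U"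
    then have "\<forall>\<^sub>F h in \<Phi>. h \<in> {h \<in> carrier G. act u h \<in> U}"
      using u \<Phi>(2) by (auto simp: limitin_def eventually_conj_iff)
    then obtain g where "(g, {h \<in> carrier G. act u h \<in> U}) \<in> I"
      using ex[of "{h \<in> carrier G. act u h \<in> U}"] by auto
    then show "\<exists>i\<in>I. \<forall>j\<in>I. pre i j \<longrightarrow> act u (fst j) \<in> U"
      by (rule bexI[rotated]) (auto simp: I_def pre_def)
  qed
  ultimately show ?thesis using x y by blast
qed

end

theory Submission
  imports Defs "HOL-Algebra.FiniteProduct"
begin

text \<open>
  The cyclic subgroups of \<open>G\<close> already form a co-decomposition: they generate \<open>G\<close>, and since
  \<open>G\<close> is abelian, acting successively by finitely many elements depends only on their product
  (\<open>foldl_act_eq_finprod\<close>), not on the order. So it suffices that a cyclic group acting on an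
  infinite Fort space is never Li--Yorke chaotic; in fact it has no scrambled pair at all.

  The particular point \<open>b\<close> is the only non-isolated point, so every group element fixes it
  (\<open>act_particular_point\<close>). If \<open>x \<noteq> y\<close> are proximal, their orbits cannot
  meet in the limit at an isolated point, because group elements act injectively; hence they
  approach \<open>b\<close>. A point with finite orbit can approach \<open>b\<close> only if it is \<open>b\<close>. So each of
  \<open>x\<close>, \<open>y\<close> is \<open>b\<close> or has an infinite orbit. A point with infinite orbit under a cyclic group
  has trivial stabiliser, so it visits any finite set only finitely often
  (\<open>finite_fibre_cyclic\<close>), that is, it lies in any given neighbourhood of \<open>b\<close> for all but
  finitely many group elements. Consequently \<open>x\<close> and \<open>y\<close> are asymptotic
  (\<open>not_scrambled_if_finite_fibres\<close>).
\<close>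

section \<open>Transformation groups\<close>

lemma transformation_group_continuous:
  assumes "transformation_group X G act" and "h \<in> carrier G"
  shows "continuous_map X X (\<lambda>x. act x h)"
proof -
  have "continuous_map X (prod_topology X (discrete_topology (carrier G))) (\<lambda>x. (x, h))"
    using assms(2) by (simp add: continuous_map_pairwise o_def)
  moreover have "continuous_map (prod_topology X (discrete_topology (carrier G))) X (\<lambda>(x, g). act x g)"
    using assms(1) by (simp add: transformation_group_def)
  ultimately show ?thesis
    using continuous_map_compose[of X _ "\<lambda>x. (x, h)" X "\<lambda>(x, g). act x g"] by (simp add: o_def)
qed

lemma transformation_group_closed:
  assumes "transformation_group X G act" and "x \<in> topspace X" and "h \<in> carrier G"
  shows "act x h \<in> topspace X"
  using continuous_map_funspace[OF transformation_group_continuous[OF assms(1,3)]] assms(2) by auto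

lemma transformation_group_mult:
  assumes "transformation_group X G act" and "x \<in> topspace X" and "g \<in> carrier G" and "h \<in> carrier G"
  shows "act x (g \<otimes>\<^bsub>G\<^esub> h) = act (act x g) h"
  using assms by (simp add: transformation_group_def)

lemma transformation_group_act_inv:
  assumes "transformation_group X G act" and "x \<in> topspace X" and "h \<in> carrier G"
  shows "act (act x h) (inv\<^bsub>G\<^esub> h) = x"
proof -
  interpret group G using assms(1) by (simp add: transformation_group_def)
  have "act (act x h) (inv\<^bsub>G\<^esub> h) = act x (h \<otimes>\<^bsub>G\<^esub> inv\<^bsub>G\<^esub> h)"
    by (rule transformation_group_mult[OF assms inv_closed[OF assms(3)], symmetric])
  also have "\<dots> = x" using assms by (simp add: transformation_group_def)
  finally show ?thesis .
qed

lemma transformation_group_inj: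
  assumes "transformation_group X G act" and "x \<in> topspace X" and "y \<in> topspace X"
    and "h \<in> carrier G" and "act x h = act y h"
  shows "x = y"
  using assms transformation_group_act_inv by metis

lemma transformation_group_subgroup:
  assumes T: "transformation_group X G act" and H: "subgroup H G"
  shows "transformation_group X (G\<lparr>carrier := H\<rparr>) act"
proof -
  have HG: "H \<subseteq> carrier G" using H by (rule subgroup.subset)
  have G: "group G" using T by (simp add: transformation_group_def)
  have "continuous_map (prod_topology X (discrete_topology H))
          (prod_topology X (discrete_topology (carrier G))) (\<lambda>p. (fst p, snd p))"
  proof (rule continuous_map_pairedI)
    show "continuous_map (prod_topology X (discrete_topology H)) X fst"
      by (rule continuous_map_fst)
    have "continuous_map (discrete_topology H) (discrete_topology (carrier G)) id"
      using HG by (simp add: Pi_iff subset_iff)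
    from continuous_map_compose[OF continuous_map_snd this]
    show "continuous_map (prod_topology X (discrete_topology H)) (discrete_topology (carrier G)) snd"
      by simp
  qed
  from continuous_map_compose[OF this, of X "\<lambda>(x, g). act x g"] T
  have "continuous_map (prod_topology X (discrete_topology H)) X (\<lambda>(x, g). act x g)"
    by (simp add: transformation_group_def o_def case_prod_unfold)
  with T HG subgroup.subgroup_is_group[OF H G] show ?thesis
    by (auto simp: transformation_group_def subset_iff)
qed

lemma foldl_act_eq_finprod:
  fixes s :: "nat \<Rightarrow> 'g" and G :: "('g, 'm) monoid_scheme"
  assumes T: "transformation_group X G act" and G: "comm_group G" and x: "x \<in> topspace X"
    and s: "\<And>i. i \<in> {1..n} \<Longrightarrow> s i \<in> carrier G"
  shows "foldl (\<lambda>y i. act y (s i)) x [1..<Suc n] = act x (finprod G s {1..n})"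
  using s
proof (induction n)
  case 0
  then show ?case using T x comm_group.axioms(1)[OF G]
    by (simp add: transformation_group_def comm_monoid.finprod_empty)
next
  case (Suc n)
  interpret comm_group G by fact
  have S: "s \<in> {1..n} \<rightarrow> carrier G" "s (Suc n) \<in> carrier G" using Suc.prems by auto
  have "finprod G s {1..Suc n} = finprod G s {1..n} \<otimes>\<^bsub>G\<^esub> s (Suc n)"
    using S by (simp add: atLeastAtMostSuc_conv m_comm)
  moreover have "foldl (\<lambda>y i. act y (s i)) x [1..<Suc n] = act x (finprod G s {1..n})"
    using Suc by auto
  ultimately show ?case
    using S x by (simp add: transformation_group_mult[OF T])
qed

lemma co_decompositionI:
  fixes \<Gamma> :: "'g set set" and G :: "('g, 'm) monoid_scheme"
  assumes T: "transformation_group X G act" and G: "comm_group G"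
    and sub: "\<And>H. H \<in> \<Gamma> \<Longrightarrow> subgroup H G" and ne: "\<Gamma> \<noteq> {}"
    and gen: "generate G (\<Union>\<Gamma>) = carrier G"
  shows "co_decomposition X G act \<Gamma> (\<lambda>H. H)"
proof -
  interpret comm_group G by fact
  have comm: "foldl (\<lambda>y i. act y (s i)) x [1..<Suc n] = foldl (\<lambda>y i. act y (s (\<sigma> i))) x [1..<Suc n]"
    if \<alpha>: "\<alpha> ` {1..n} \<subseteq> \<Gamma>" and x: "x \<in> topspace X"
      and s: "\<forall>i\<in>{1..n}. s i \<in> \<alpha> i" and \<sigma>: "\<sigma> permutes {1..n}"
    for n :: nat and \<alpha> x s \<sigma>
  proof -
    have sG: "s i \<in> carrier G" if "i \<in> {1..n}" for i
      using that \<alpha> s sub[THEN subgroup.subset] by blast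
    have \<sigma>G: "s (\<sigma> i) \<in> carrier G" if "i \<in> {1..n}" for i
      using that sG permutes_in_image[OF \<sigma>] by blast
    have "finprod G s (\<sigma> ` {1..n}) = finprod G (\<lambda>i. s (\<sigma> i)) {1..n}"
      using sG permutes_inj_on[OF \<sigma>] permutes_image[OF \<sigma>] by (intro finprod_reindex) auto
    then have "finprod G s {1..n} = finprod G (\<lambda>i. s (\<sigma> i)) {1..n}"
      by (simp only: permutes_image[OF \<sigma>])
    with foldl_act_eq_finprod[where s = s, OF T G x sG]
      foldl_act_eq_finprod[where s = "\<lambda>i. s (\<sigma> i)", OF T G x \<sigma>G]
    show ?thesis by (simp only:)
  qed
  have "multi_transformation_group X \<Gamma> (\<lambda>H. G\<lparr>carrier := H\<rparr>) (\<lambda>_. act)"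
    unfolding multi_transformation_group_def
  proof (intro conjI ballI allI impI)
    fix n :: nat and \<alpha> x s \<sigma>
    assume "inj_on \<alpha> {1..n} \<and> \<alpha> ` {1..n} \<subseteq> \<Gamma> \<and> x \<in> topspace X \<and>
      (\<forall>i\<in>{1..n}. s i \<in> carrier (G\<lparr>carrier := \<alpha> i\<rparr>)) \<and> \<sigma> permutes {1..n}"
    then have "\<alpha> ` {1..n} \<subseteq> \<Gamma>" "x \<in> topspace X" "\<forall>i\<in>{1..n}. s i \<in> \<alpha> i" "\<sigma> permutes {1..n}"
      by simp_all
    then show "foldl (\<lambda>y i. act y (s i)) x [1..<Suc n] = foldl (\<lambda>y i. act y (s (\<sigma> i))) x [1..<Suc n]"
      by (rule comm)
  qed (use ne transformation_group_subgroup[OF T sub] in auto)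
  then show ?thesis
    using T sub gen by (simp add: co_decomposition_def)
qed

section \<open>Orbits of cyclic groups\<close>

lemma finite_range_periodic:
  fixes f :: "int \<Rightarrow> 'a"
  assumes "m > 0" and per: "\<And>n. f (n + m) = f n"
  shows "finite (range f)"
proof -
  have "f (n + k * m) = f n" for n k
  proof (induction k rule: int_induct[where k = 0])
    case (step1 i)
    then show ?case using per[of "n + i * m"] by (simp add: algebra_simps)
  next
    case (step2 i)
    then show ?case using per[of "n + (i - 1) * m"] by (simp add: algebra_simps)
  qed simp
  then have "f n = f (n mod m)" for n
    by (metis mod_div_mult_eq)
  moreover have "n mod m \<in> {0..<m}" for n using assms(1) by simp
  ultimately have "range f \<subseteq> f ` {0..<m}" by blast
  then show ?thesis by (rule finite_subset) simp
qed

text \<open>Two elements of the fibre differ by a nonzero power of \<open>g\<close> fixing \<open>x\<close>; then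
  \<open>n \<mapsto> x g\<^sup>n\<close> is periodic, and the orbit is finite.\<close>

lemma finite_fibre_cyclic:
  assumes T: "transformation_group X G act" and x: "x \<in> topspace X" and g: "g \<in> carrier G"
    and inf: "infinite (act x ` generate G {g})"
  shows "finite {h \<in> generate G {g}. act x h = y}"
proof -
  interpret group G using T by (simp add: transformation_group_def)
  define f where "f = (\<lambda>n::int. act x (g [^]\<^bsub>G\<^esub> n))"
  have gen: "generate G {g} = range (\<lambda>n::int. g [^]\<^bsub>G\<^esub> n)"
    using generate_pow[OF g] by auto
  then have orb: "act x ` generate G {g} = range f" by (auto simp: f_def)
  have add: "f (m + n) = act (f m) (g [^]\<^bsub>G\<^esub> n)" for m n
    using x g by (simp add: f_def int_pow_mult transformation_group_mult[OF T])
  have inj: "\<not> i < j" if "f i = f j" for i j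
  proof
    assume "i < j"
    have "f (n + (j - i)) = f n" for n
      using that add[of i "n - i"] add[of j "n - i"] by (simp add: algebra_simps)
    with \<open>i < j\<close> have "finite (range f)" by (intro finite_range_periodic[of "j - i"]) auto
    with inf orb show False by simp
  qed
  have "h = k" if hk: "h \<in> generate G {g}" "k \<in> generate G {g}" "act x h = act x k" for h k
  proof -
    obtain i j :: int where "h = g [^]\<^bsub>G\<^esub> i" "k = g [^]\<^bsub>G\<^esub> j"
      using hk(1,2) gen by blast
    with hk(3) inj[of i j] inj[of j i] show ?thesis
      by (simp add: f_def)
  qed
  then have "{h \<in> generate G {g}. act x h = y} \<subseteq> {k}"
    if "k \<in> generate G {g}" "act x k = y" for k using that by blast
  then show ?thesis
    by (cases "\<exists>k\<in>generate G {g}. act x k = y") (auto intro: finite_subset[of _ "{_}"])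
qed

section \<open>Actions on infinite Fort spaces\<close>

lemma act_particular_point:
  assumes T: "transformation_group (fort_topology F b) G act" and b: "b \<in> F" and F: "infinite F"
    and h: "h \<in> carrier G"
  shows "act b h = b"
proof (rule ccontr)
  assume ne: "act b h \<noteq> b"
  have "act b h \<in> F" using transformation_group_closed[OF T _ h] b by simp
  with ne have "openin (fort_topology F b) {act b h}" by (simp add: openin_fort_topology)
  from openin_continuous_map_preimage[OF transformation_group_continuous[OF T h] this]
  have "openin (fort_topology F b) {x \<in> F. act x h = act b h}" by simp
  also have "{x \<in> F. act x h = act b h} = {b}"
    using transformation_group_inj[OF T _ _ h] b by auto
  finally show False using F by (simp add: openin_fort_topology)
qed

text \<open>At an isolated common limit, some group element would send \<open>x\<close> and \<open>y\<close> to the same point;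
  so the limit is \<open>b\<close>.\<close>

lemma proximal_fort_limit:
  assumes T: "transformation_group (fort_topology F b) G act"
    and x: "x \<in> F" and y: "y \<in> F" and "x \<noteq> y" and prox: "proximal (fort_topology F b) G act x y"
  obtains \<Phi> where "\<Phi> \<noteq> bot" and "\<forall>\<^sub>F g in \<Phi>. g \<in> carrier G"
    and "limitin (fort_topology F b) (act x) b \<Phi>" and "limitin (fort_topology F b) (act y) b \<Phi>"
proof -
  obtain z \<Phi> where z: "z \<in> F" and \<Phi>: "\<Phi> \<noteq> bot" "\<forall>\<^sub>F g in \<Phi>. g \<in> carrier G"
    and lim: "limitin (fort_topology F b) (act x) z \<Phi>" "limitin (fort_topology F b) (act y) z \<Phi>"
    using prox by (auto simp: proximal_def)
  have "z = b"
  proof (rule ccontr)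
    assume "z \<noteq> b"
    with z have "openin (fort_topology F b) {z}" by (simp add: openin_fort_topology)
    with lim have "\<forall>\<^sub>F g in \<Phi>. act x g \<in> {z}" "\<forall>\<^sub>F g in \<Phi>. act y g \<in> {z}"
      unfolding limitin_def by blast+
    with \<Phi>(2) have "\<forall>\<^sub>F g in \<Phi>. g \<in> carrier G \<and> act x g = act y g"
      by eventually_elim auto
    then obtain g where "g \<in> carrier G" "act x g = act y g"
      using eventually_happens'[OF \<Phi>(1)] by blast
    then show False using transformation_group_inj[OF T] x y \<open>x \<noteq> y\<close> by auto
  qed
  with that \<Phi> lim show thesis by blast
qed

text \<open>The complement of a finite orbit not containing \<open>b\<close> is a neighbourhood of \<open>b\<close> that the
  orbit never enters.\<close>

lemma infinite_orbit_if_limit: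
  assumes T: "transformation_group (fort_topology F b) G act" and b: "b \<in> F" and F: "infinite F"
    and x: "x \<in> F" and \<Phi>: "\<Phi> \<noteq> bot" "\<forall>\<^sub>F g in \<Phi>. g \<in> carrier G"
    and lim: "limitin (fort_topology F b) (act x) b \<Phi>" and "x \<noteq> b"
  shows "infinite (act x ` carrier G)"
proof
  assume fin: "finite (act x ` carrier G)"
  have "b \<notin> act x ` carrier G"
  proof
    assume "b \<in> act x ` carrier G"
    then obtain h where h: "h \<in> carrier G" "act x h = b" by auto
    then show False
      using act_particular_point[OF T b F h(1)] transformation_group_inj[OF T _ _ h(1), of x b] x b \<open>x \<noteq> b\<close>
      by simp
  qed
  then have "openin (fort_topology F b) (F - act x ` carrier G)" "b \<in> F - act x ` carrier G"
    using fin b by (auto simp: openin_fort_topology Diff_Diff_Int)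
  then have "\<forall>\<^sub>F g in \<Phi>. act x g \<in> F - act x ` carrier G"
    using lim unfolding limitin_def by blast
  with \<Phi>(2) have "\<forall>\<^sub>F g in \<Phi>. False" by eventually_elim auto
  with \<Phi>(1) show False by (simp add: trivial_limit_def)
qed

lemma fort_entourage:
  assumes b: "b \<in> F" and V: "V \<in> the_uniformity (fort_topology F b)"
  obtains U where "openin (fort_topology F b) U" and "b \<in> U" and "U \<times> U \<subseteq> V"
proof -
  note comp = compact_space_fort_topology[OF b] and haus = Hausdorff_space_fort_topology[of F b]
  have "the_uniformity (fort_topology F b) = diagonal_nhds (fort_topology F b)"
    unfolding the_uniformity_def
    using ex1_compatible_uniformity[OF comp haus] compatible_diagonal_nhds[OF comp haus]
    by (rule the1_equality)
  with V obtain W where W: "openin (prod_topology (fort_topology F b) (fort_topology F b)) W"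
    "Id_on F \<subseteq> W" "W \<subseteq> V" by (auto simp: diagonal_nhds_def)
  with b have "(b, b) \<in> W" by blast
  with W(1) obtain A B where "openin (fort_topology F b) A" "openin (fort_topology F b) B"
    "b \<in> A" "b \<in> B" "A \<times> B \<subseteq> W"
    unfolding openin_prod_topology_alt by meson
  with W(3) show thesis by (intro that[of "A \<inter> B"]) auto
qed

text \<open>A neighbourhood of \<open>b\<close> misses only finitely many points, all different from \<open>b\<close>, so finite
  fibres keep both orbits inside it up to finitely many group elements.\<close>

lemma asymptotic_if_finite_fibres:
  assumes T: "transformation_group (fort_topology F b) G act" and b: "b \<in> F"
    and x: "x \<in> F" and y: "y \<in> F"
    and fx: "\<And>p. p \<noteq> b \<Longrightarrow> finite {h \<in> carrier G. act x h = p}"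
    and fy: "\<And>p. p \<noteq> b \<Longrightarrow> finite {h \<in> carrier G. act y h = p}"
  shows "asymptotic (fort_topology F b) G act x y"
  unfolding asymptotic_def
proof
  fix V assume "V \<in> the_uniformity (fort_topology F b)"
  then obtain U where U: "openin (fort_topology F b) U" "b \<in> U" "U \<times> U \<subseteq> V"
    using fort_entourage[OF b] by metis
  then have fin: "finite (F - U)" by (simp add: openin_fort_topology)
  have cl: "act u h \<in> F" if "u \<in> F" "h \<in> carrier G" for u h
    using transformation_group_closed[OF T _ that(2)] that(1) by simp
  have "{h \<in> carrier G. (act x h, act y h) \<notin> V} \<subseteq>
    (\<Union>p\<in>F - U. {h \<in> carrier G. act x h = p} \<union> {h \<in> carrier G. act y h = p})"
  proof
    fix h assume h: "h \<in> {h \<in> carrier G. (act x h, act y h) \<notin> V}"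
    then have "act x h \<notin> U \<or> act y h \<notin> U" using U(3) by blast
    moreover have "act x h \<in> F" "act y h \<in> F" using cl x y h by simp_all
    ultimately show "h \<in> (\<Union>p\<in>F - U. {h \<in> carrier G. act x h = p} \<union> {h \<in> carrier G. act y h = p})"
      using h by blast
  qed
  moreover have "finite (\<Union>p\<in>F - U. {h \<in> carrier G. act x h = p} \<union> {h \<in> carrier G. act y h = p})"
  proof (intro finite_UN_I finite_UnI)
    fix p assume "p \<in> F - U"
    with U(2) have "p \<noteq> b" by blast
    then show "finite {h \<in> carrier G. act x h = p}" "finite {h \<in> carrier G. act y h = p}"
      by (fact fx, fact fy)
  qed (fact fin)
  ultimately show "finite {h \<in> carrier G. (act x h, act y h) \<notin> V}"
    by (rule finite_subset)
qed

lemma not_scrambled_if_finite_fibres: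
  assumes T: "transformation_group (fort_topology F b) G act" and b: "b \<in> F" and F: "infinite F"
    and fib: "\<And>u p. u \<in> F \<Longrightarrow> infinite (act u ` carrier G) \<Longrightarrow> finite {h \<in> carrier G. act u h = p}"
    and x: "x \<in> F" and y: "y \<in> F" and "x \<noteq> y"
  shows "\<not> scrambled (fort_topology F b) G act x y"
proof
  assume scr: "scrambled (fort_topology F b) G act x y"
  then obtain \<Phi> where \<Phi>: "\<Phi> \<noteq> bot" "\<forall>\<^sub>F g in \<Phi>. g \<in> carrier G"
    and lim: "limitin (fort_topology F b) (act x) b \<Phi>" "limitin (fort_topology F b) (act y) b \<Phi>"
    using proximal_fort_limit[OF T x y \<open>x \<noteq> y\<close>] by (metis scrambled_def)
  have "finite {h \<in> carrier G. act u h = p}"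
    if "u \<in> F" "limitin (fort_topology F b) (act u) b \<Phi>" "p \<noteq> b" for u p
  proof (cases "u = b")
    case True
    then have "{h \<in> carrier G. act u h = p} = {}"
      using act_particular_point[OF T b F] that(3) by auto
    then show ?thesis by (metis finite.emptyI)
  next
    case False
    then show ?thesis using fib infinite_orbit_if_limit[OF T b F that(1) \<Phi> that(2)] that(1) by blast
  qed
  then have "asymptotic (fort_topology F b) G act x y"
    using asymptotic_if_finite_fibres[OF T b x y] lim x y by blast
  with scr show False by (simp add: scrambled_def)
qed

lemma not_Li_Yorke_chaotic_cyclic:
  assumes T: "transformation_group (fort_topology F b) G act" and b: "b \<in> F" and F: "infinite F"
    and g: "g \<in> carrier G"
  shows "\<not> Li_Yorke_chaotic (fort_topology F b) (G\<lparr>carrier := generate G {g}\<rparr>) act"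
proof
  let ?C = "G\<lparr>carrier := generate G {g}\<rparr>"
  assume "Li_Yorke_chaotic (fort_topology F b) ?C act"
  then obtain D where D: "D \<subseteq> F" "uncountable D"
    "\<And>x y. x \<in> D \<Longrightarrow> y \<in> D \<Longrightarrow> x \<noteq> y \<Longrightarrow> scrambled (fort_topology F b) ?C act x y"
    by (auto simp: Li_Yorke_chaotic_def)
  obtain x where x: "x \<in> D" using D(2) by fastforce
  have "D \<noteq> {x}" using D(2) by auto
  with x obtain y where y: "y \<in> D" "x \<noteq> y" by blast
  have "group G" using T by (simp add: transformation_group_def)
  then have "transformation_group (fort_topology F b) ?C act"
    using g by (intro transformation_group_subgroup[OF T] group.generate_is_subgroup) auto
  then have "\<not> scrambled (fort_topology F b) ?C act x y"
  proof (rule not_scrambled_if_finite_fibres[OF _ b F])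
    show "finite {h \<in> carrier ?C. act u h = p}" if "u \<in> F" "infinite (act u ` carrier ?C)" for u p
      using finite_fibre_cyclic[OF T _ g, of u p] that by simp
  qed (use x y D(1) in auto)
  with D(3) x y show False by blast
qed

theorem mainTheorem2:
  fixes F :: "'a set" and b :: 'a
    and G :: "('g, 'm) monoid_scheme" and act :: "'a \<Rightarrow> 'g \<Rightarrow> 'a"
  assumes "b \<in> F" and "infinite F"
    and "transformation_group (fort_topology F b) G act"
    and "comm_group G"
  shows "\<exists>(\<Gamma> :: 'g set set) (H :: 'g set \<Rightarrow> 'g set).
           co_decomposition (fort_topology F b) G act \<Gamma> H \<and>
           (\<forall>\<alpha>\<in>\<Gamma>. \<not> Li_Yorke_chaotic (fort_topology F b) (G\<lparr>carrier := H \<alpha>\<rparr>) act)"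
proof -
  interpret comm_group G by fact
  let ?\<Gamma> = "(\<lambda>g. generate G {g}) ` carrier G"
  have sub: "subgroup H G" if "H \<in> ?\<Gamma>" for H
    using that by (auto intro: generate_is_subgroup)
  have "carrier G \<subseteq> \<Union>?\<Gamma>" by (auto intro: generate.incl)
  moreover have "\<Union>?\<Gamma> \<subseteq> carrier G" using sub subgroup.subset by blast
  ultimately have "\<Union>?\<Gamma> = carrier G" by blast
  moreover have "generate G (carrier G) = carrier G"
    by (intro subset_antisym generate_incl order_refl) (auto intro: generate.incl)
  ultimately have "co_decomposition (fort_topology F b) G act ?\<Gamma> (\<lambda>H. H)"
    using carrier_not_empty by (intro co_decompositionI assms sub) auto
  moreover have "\<forall>H\<in>?\<Gamma>. \<not> Li_Yorke_chaotic (fort_topology F b) (G\<lparr>carrier := H\<rparr>) act"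
    using not_Li_Yorke_chaotic_cyclic[OF assms(3,1,2)] by blast
  ultimately show ?thesis by blast
qed

end
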